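(* The inclusion functor $\iota:\mathbf{\Omega}\to\mathbf{SCvx}$ is dense. Equivalently, the restricted Yoneda functor $\mathbf{SCvx}\to\mathbf{Set}^{\mathbf{\Omega}^{op}}$, $A\mapsto\mathbf{SCvx}(\iota(\_),A)$, is full and faithful.
   Context: $\mathbb{N}=\{0,1,2,\dots\}$. $\mathcal{G}\mathbb{N}$ is the set of sequences $\mathbf{p}:\mathbb{N}\to[0,1]$ with $\sum_i p_i=1$, identified with the probability measures $\sum_i p_i\delta_i$ on $\mathbb{N}$. A super convex space is a set $A$ with a function $\mathcal{G}\mathbb{N}\times A^{\mathbb{N}}\to A$, $(\mathbf{p},\mathbf{a})\mapsto\sum_{i\in\mathbb{N}}p_ia_i$, such that (1) for $\mathbf{p}=\delta_j$ the value is $a_j$, and (2) $\sum_j p_j(\sum_i Q^j_i a_i)=\sum_i(\sum_j p_jQ^j_i)a_i$ for all $\mathbf{p}\in\mathcal{G}\mathbb{N}$, all sequences $\mathbf{Q}:\mathbb{N}\to\mathcal{G}\mathbb{N}$ and all $\mathbf{a}:\mathbb{N}\to A$. A countably affine map is a function $m$ with $m(\sum_i p_ia_i)=\sum_i p_i m(a_i)$ always. Super convex spaces and countably affine maps form the category $\mathbf{SCvx}$. $\Delta_{\mathbb{N}}$ is the set $\mathcal{G}\mathbb{N}$ as a super convex space with countably affine sums taken coefficientwise. $\mathsf{N}$ is the set of natural numbers with super convex structure $\sum_i p_iu_i=\min\{u_i\mid p_i>0\}$. $\mathbf{\Omega}$ is the full subcategory of $\mathbf{SCvx}$ on the two objects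 $\mathsf{N}$ and $\Delta_{\mathbb{N}}$, and $\iota$ is its inclusion. *)

theory Defs
  imports Complex_Main "HOL-Library.FuncSet"
begin

text \<open>
  Categories are given by families of hom-sets, which need not be disjoint; composition and the
  action of a functor on morphisms therefore take the objects as arguments:
  \<open>Comp C X Y Z g f\<close> is the composite of \<open>f : X \<rightarrow> Y\<close> and \<open>g : Y \<rightarrow> Z\<close>.
  As usual for record-based structures, all operations are unconstrained outside their domain,
  so a functor or a space may have several representatives; these are isomorphic via the
  identity. Morphisms, on the other hand, are always represented uniquely (functions are extensional).
\<close>

record ('o, 'm) cat =
  Obj :: "'o set"
  Hom :: "'o \<Rightarrow> 'o \<Rightarrow> 'm set"
  Ident :: "'o \<Rightarrow> 'm"
  Comp :: "'o \<Rightarrow> 'o \<Rightarrow> 'o \<Rightarrow> 'm \<Rightarrow> 'm \<Rightarrow> 'm"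

definition category :: "('o, 'm) cat \<Rightarrow> bool" where
  "category C \<longleftrightarrow>
     (\<forall>X\<in>Obj C. Ident C X \<in> Hom C X X) \<and>
     (\<forall>X\<in>Obj C. \<forall>Y\<in>Obj C. \<forall>Z\<in>Obj C. \<forall>f\<in>Hom C X Y. \<forall>g\<in>Hom C Y Z.
        Comp C X Y Z g f \<in> Hom C X Z) \<and>
     (\<forall>X\<in>Obj C. \<forall>Y\<in>Obj C. \<forall>f\<in>Hom C X Y.
        Comp C X X Y f (Ident C X) = f \<and> Comp C X Y Y (Ident C Y) f = f) \<and>
     (\<forall>W\<in>Obj C. \<forall>X\<in>Obj C. \<forall>Y\<in>Obj C. \<forall>Z\<in>Obj C.
        \<forall>f\<in>Hom C W X. \<forall>g\<in>Hom C X Y. \<forall>h\<in>Hom C Y Z.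
          Comp C W X Z (Comp C X Y Z h g) f = Comp C W Y Z h (Comp C W X Y g f))"

record ('o, 'm, 'p, 'n) functr =
  omap :: "'o \<Rightarrow> 'p"
  mmap :: "'o \<Rightarrow> 'o \<Rightarrow> 'm \<Rightarrow> 'n"

definition is_functor :: "('o, 'm) cat \<Rightarrow> ('p, 'n) cat \<Rightarrow> ('o, 'm, 'p, 'n) functr \<Rightarrow> bool" where
  "is_functor C D F \<longleftrightarrow>
     category C \<and> category D \<and>
     (\<forall>X\<in>Obj C. omap F X \<in> Obj D) \<and>
     (\<forall>X\<in>Obj C. \<forall>Y\<in>Obj C. \<forall>f\<in>Hom C X Y. mmap F X Y f \<in> Hom D (omap F X) (omap F Y)) \<and>
     (\<forall>X\<in>Obj C. mmap F X X (Ident C X) = Ident D (omap F X)) \<and>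
     (\<forall>X\<in>Obj C. \<forall>Y\<in>Obj C. \<forall>Z\<in>Obj C. \<forall>f\<in>Hom C X Y. \<forall>g\<in>Hom C Y Z.
        mmap F X Z (Comp C X Y Z g f) =
          Comp D (omap F X) (omap F Y) (omap F Z) (mmap F Y Z g) (mmap F X Y f))"

definition functor_comp ::
    "('p, 'n, 'q, 'k) functr \<Rightarrow> ('o, 'm, 'p, 'n) functr \<Rightarrow> ('o, 'm, 'q, 'k) functr" where
  "functor_comp G F =
     \<lparr>omap = (\<lambda>X. omap G (omap F X)),
      mmap = (\<lambda>X Y f. mmap G (omap F X) (omap F Y) (mmap F X Y f))\<rparr>"

definition full :: "('o, 'm) cat \<Rightarrow> ('p, 'n) cat \<Rightarrow> ('o, 'm, 'p, 'n) functr \<Rightarrow> bool" where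
  "full C D F \<longleftrightarrow>
     (\<forall>X\<in>Obj C. \<forall>Y\<in>Obj C. \<forall>g\<in>Hom D (omap F X) (omap F Y). \<exists>f\<in>Hom C X Y. mmap F X Y f = g)"

definition faithful :: "('o, 'm) cat \<Rightarrow> ('o, 'm, 'p, 'n) functr \<Rightarrow> bool" where
  "faithful C F \<longleftrightarrow> (\<forall>X\<in>Obj C. \<forall>Y\<in>Obj C. inj_on (mmap F X Y) (Hom C X Y))"

definition full_subcategory :: "('o, 'm) cat \<Rightarrow> 'o set \<Rightarrow> ('o, 'm) cat" where
  "full_subcategory C S = C\<lparr>Obj := S\<rparr>"

definition inclusion_functor :: "('o, 'm, 'o, 'm) functr" where
  "inclusion_functor = \<lparr>omap = (\<lambda>X. X), mmap = (\<lambda>X Y f. f)\<rparr>"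

definition op_cat :: "('o, 'm) cat \<Rightarrow> ('o, 'm) cat" where
  "op_cat C =
     \<lparr>Obj = Obj C, Hom = (\<lambda>X Y. Hom C Y X), Ident = Ident C,
      Comp = (\<lambda>X Y Z g f. Comp C Z Y X f g)\<rparr>"

text \<open>The category of sets whose elements are taken from the type \<open>'x\<close>.\<close>

definition Set_cat :: "('x set, 'x \<Rightarrow> 'x) cat" where
  "Set_cat =
     \<lparr>Obj = UNIV, Hom = (\<lambda>X Y. X \<rightarrow>\<^sub>E Y), Ident = (\<lambda>X. \<lambda>x\<in>X. x),
      Comp = (\<lambda>X Y Z g f. compose X g f)\<rparr>"

definition nat_trans ::
    "('o, 'm) cat \<Rightarrow> ('p, 'n) cat \<Rightarrow> ('o, 'm, 'p, 'n) functr \<Rightarrow> ('o, 'm, 'p, 'n) functr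
       \<Rightarrow> ('o \<Rightarrow> 'n) set" where
  "nat_trans C D F G =
     {\<eta> \<in> (\<Pi>\<^sub>E X\<in>Obj C. Hom D (omap F X) (omap G X)).
        \<forall>X\<in>Obj C. \<forall>Y\<in>Obj C. \<forall>f\<in>Hom C X Y.
          Comp D (omap F X) (omap F Y) (omap G Y) (\<eta> Y) (mmap F X Y f) =
          Comp D (omap F X) (omap G X) (omap G Y) (mmap G X Y f) (\<eta> X)}"

definition functor_cat ::
    "('o, 'm) cat \<Rightarrow> ('p, 'n) cat \<Rightarrow> (('o, 'm, 'p, 'n) functr, 'o \<Rightarrow> 'n) cat" where
  "functor_cat C D =
     \<lparr>Obj = {F. is_functor C D F},
      Hom = nat_trans C D,
      Ident = (\<lambda>F. \<lambda>X\<in>Obj C. Ident D (omap F X)),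
      Comp = (\<lambda>F G H \<theta> \<eta>. \<lambda>X\<in>Obj C. Comp D (omap F X) (omap G X) (omap H X) (\<theta> X) (\<eta> X))\<rparr>"

text \<open>
  For \<open>K : C \<rightarrow> D\<close>, the functor \<open>D \<rightarrow> Set\<^bsup>C\<^sup>o\<^sup>p\<^esup>\<close>
  sending \<open>d\<close> to \<open>D(K _, d)\<close>. Its presheaves take values in sets of morphisms of \<open>D\<close>.
\<close>

definition hom_presheaf ::
    "('o, 'm) cat \<Rightarrow> ('p, 'n) cat \<Rightarrow> ('o, 'm, 'p, 'n) functr \<Rightarrow> 'p
       \<Rightarrow> ('o, 'm, 'n set, 'n \<Rightarrow> 'n) functr" where
  "hom_presheaf C D K d =
     \<lparr>omap = (\<lambda>c. Hom D (omap K c) d),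
      mmap = (\<lambda>c c' u. \<lambda>x\<in>Hom D (omap K c) d.
                Comp D (omap K c') (omap K c) d x (mmap K c' c u))\<rparr>"

definition restricted_yoneda ::
    "('o, 'm) cat \<Rightarrow> ('p, 'n) cat \<Rightarrow> ('o, 'm, 'p, 'n) functr
       \<Rightarrow> ('p, 'n, ('o, 'm, 'n set, 'n \<Rightarrow> 'n) functr, 'o \<Rightarrow> 'n \<Rightarrow> 'n) functr" where
  "restricted_yoneda C D K =
     \<lparr>omap = hom_presheaf C D K,
      mmap = (\<lambda>d d' g. \<lambda>c\<in>Obj C. \<lambda>x\<in>Hom D (omap K c) d. Comp D (omap K c) d d' g x)\<rparr>"

definition comma_cat ::
    "('o, 'm) cat \<Rightarrow> ('p, 'n) cat \<Rightarrow> ('o, 'm, 'p, 'n) functr \<Rightarrow> 'p \<Rightarrow> ('o \<times> 'n, 'm) cat" where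
  "comma_cat C D K d =
     \<lparr>Obj = (SIGMA c : Obj C. Hom D (omap K c) d),
      Hom = (\<lambda>(c, f) (c', f'). {u \<in> Hom C c c'.
                Comp D (omap K c) (omap K c') d f' (mmap K c c' u) = f}),
      Ident = (\<lambda>(c, f). Ident C c),
      Comp = (\<lambda>(c, f) (c', f') (c'', f'') v u. Comp C c c' c'' v u)\<rparr>"

definition comma_proj :: "('o \<times> 'n, 'm, 'o, 'm) functr" where
  "comma_proj = \<lparr>omap = fst, mmap = (\<lambda>X Y u. u)\<rparr>"

definition is_cocone ::
    "('j, 'l) cat \<Rightarrow> ('p, 'n) cat \<Rightarrow> ('j, 'l, 'p, 'n) functr \<Rightarrow> 'p \<Rightarrow> ('j \<Rightarrow> 'n) \<Rightarrow> bool" where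
  "is_cocone J D F d \<mu> \<longleftrightarrow>
     d \<in> Obj D \<and>
     (\<forall>j\<in>Obj J. \<mu> j \<in> Hom D (omap F j) d) \<and>
     (\<forall>j\<in>Obj J. \<forall>j'\<in>Obj J. \<forall>u\<in>Hom J j j'.
        Comp D (omap F j) (omap F j') d (\<mu> j') (mmap F j j' u) = \<mu> j)"

definition is_colimit ::
    "('j, 'l) cat \<Rightarrow> ('p, 'n) cat \<Rightarrow> ('j, 'l, 'p, 'n) functr \<Rightarrow> 'p \<Rightarrow> ('j \<Rightarrow> 'n) \<Rightarrow> bool" where
  "is_colimit J D F d \<mu> \<longleftrightarrow>
     is_functor J D F \<and> is_cocone J D F d \<mu> \<and>
     (\<forall>d' \<nu>. is_cocone J D F d' \<nu> \<longrightarrow>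
        (\<exists>!g. g \<in> Hom D d d' \<and> (\<forall>j\<in>Obj J. Comp D (omap F j) d d' g (\<mu> j) = \<nu> j)))"

text \<open>
  \<open>K : C \<rightarrow> D\<close> is dense if every object \<open>d\<close> of \<open>D\<close> is, via the canonical cocone,
  the colimit of \<open>K \<down> d \<rightarrow> C \<rightarrow> D\<close>.
\<close>

definition dense_functor ::
    "('o, 'm) cat \<Rightarrow> ('p, 'n) cat \<Rightarrow> ('o, 'm, 'p, 'n) functr \<Rightarrow> bool" where
  "dense_functor C D K \<longleftrightarrow>
     is_functor C D K \<and>
     (\<forall>d\<in>Obj D. is_colimit (comma_cat C D K d) D (functor_comp K comma_proj) d (\<lambda>(c, f). f))"


definition GN :: "(nat \<Rightarrow> real) set" where
  "GN = {p. (\<forall>i. 0 \<le> p i \<and> p i \<le> 1) \<and> p sums 1}"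

definition dirac :: "nat \<Rightarrow> nat \<Rightarrow> real" where
  "dirac j = (\<lambda>i. if i = j then 1 else 0)"

definition mix :: "(nat \<Rightarrow> real) \<Rightarrow> (nat \<Rightarrow> nat \<Rightarrow> real) \<Rightarrow> nat \<Rightarrow> real" where
  "mix p Q = (\<lambda>i. \<Sum>j. p j * Q j i)"

record 'a sc_space =
  carrier :: "'a set"
  csum :: "(nat \<Rightarrow> real) \<Rightarrow> (nat \<Rightarrow> 'a) \<Rightarrow> 'a"

definition super_convex_space :: "'a sc_space \<Rightarrow> bool" where
  "super_convex_space A \<longleftrightarrow>
     (\<forall>p\<in>GN. \<forall>a \<in> UNIV \<rightarrow> carrier A. csum A p a \<in> carrier A) \<and>
     (\<forall>j. \<forall>a \<in> UNIV \<rightarrow> carrier A. csum A (dirac j) a = a j) \<and>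
     (\<forall>p\<in>GN. \<forall>Q \<in> UNIV \<rightarrow> GN. \<forall>a \<in> UNIV \<rightarrow> carrier A.
        csum A p (\<lambda>j. csum A (Q j) a) = csum A (mix p Q) a)"

definition countably_affine :: "'a sc_space \<Rightarrow> 'b sc_space \<Rightarrow> ('a \<Rightarrow> 'b) set" where
  "countably_affine A B =
     {m \<in> carrier A \<rightarrow>\<^sub>E carrier B.
        \<forall>p\<in>GN. \<forall>a \<in> UNIV \<rightarrow> carrier A. m (csum A p a) = csum B p (\<lambda>i. m (a i))}"

text \<open>
  The super convex spaces with elements taken from the type \<open>'u\<close>; any super convex space can be
  accommodated by choosing \<open>'u\<close> large enough.
\<close>

type_synonym 'u sc_cat = "('u sc_space, 'u \<Rightarrow> 'u) cat"

definition SCvx :: "'u sc_cat" where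
  "SCvx =
     \<lparr>Obj = {A. super_convex_space A},
      Hom = countably_affine,
      Ident = (\<lambda>A. \<lambda>x\<in>carrier A. x),
      Comp = (\<lambda>A B C g f. compose (carrier A) g f)\<rparr>"

definition simplex_space :: "(nat \<Rightarrow> real) sc_space" where
  "simplex_space = \<lparr>carrier = GN, csum = mix\<rparr>"

definition nat_space :: "nat sc_space" where
  "nat_space = \<lparr>carrier = UNIV, csum = (\<lambda>p u. LEAST n. \<exists>i. p i > 0 \<and> n = u i)\<rparr>"

text \<open>
  All objects of \<open>SCvx\<close> have their elements in one type, which has to contain the elements of the
  two spaces above. We take \<open>'a point\<close>, where \<open>'a\<close> is arbitrary, and work with the evident
  copies of the two spaces in it. Every type with at least continuum many elements is in
  bijection with a type of this form, so this imposes no restriction on the remaining spaces.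
\<close>

datatype 'a point = Nat_Point nat | Seq_Point "nat \<Rightarrow> real" | Point 'a

definition transport :: "('a \<Rightarrow> 'b) \<Rightarrow> 'a sc_space \<Rightarrow> 'b sc_space" where
  "transport e A =
     \<lparr>carrier = e ` carrier A,
      csum = (\<lambda>p a. e (csum A p (\<lambda>i. inv_into (carrier A) e (a i))))\<rparr>"

definition N_obj :: "'a point sc_space" where
  "N_obj = transport Nat_Point nat_space"

definition Delta_obj :: "'a point sc_space" where
  "Delta_obj = transport Seq_Point simplex_space"

definition Omega :: "'a point sc_cat" where
  "Omega = full_subcategory SCvx {N_obj, Delta_obj}"

definition iota ::
    "('a point sc_space, 'a point \<Rightarrow> 'a point, 'a point sc_space, 'a point \<Rightarrow> 'a point) functr" where
  "iota = inclusion_functor"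

end

theory Submission
  imports Defs "HOL-Analysis.Infinite_Sum" "HOL-Analysis.Elementary_Metric_Spaces"
begin

text \<open>
  The simplex \<open>\<Delta>\<^sub>\<nat>\<close> is the free super convex space on \<open>\<nat>\<close>, with the point masses \<open>\<delta>\<^sub>j\<close> as
  generators: each \<open>p\<close> is the sum \<open>\<Sum>\<^sub>j p\<^sub>j\<delta>\<^sub>j\<close>, and a sequence \<open>a\<close> in \<open>A\<close> extends to the affine map
  \<open>p \<mapsto> \<Sum>\<^sub>j p\<^sub>ja\<^sub>j\<close>. Moreover, constant maps are countably affine, so a point \<open>x\<close> of \<open>A\<close> is
  visible as the constant map \<open>\<Delta>\<^sub>\<nat> \<rightarrow> A\<close> with value \<open>x\<close>.

  Let \<open>\<phi>\<close> send the maps \<open>c \<rightarrow> A\<close>, for \<open>c\<close> in the subcategory, to maps \<open>c \<rightarrow> B\<close>, naturally in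
  \<open>c\<close>. A map \<open>g\<close> with \<open>\<phi> f = g \<circ> f\<close> for all \<open>f\<close> can only be \<open>g x = \<phi> (const x) \<delta>\<^sub>0\<close>. This \<open>g\<close> works:
  composing \<open>f : c \<rightarrow> A\<close> with the constant map \<open>\<Delta>\<^sub>\<nat> \<rightarrow> c\<close> at \<open>x\<close> yields the constant map
  at \<open>f x\<close>, and naturality turns this into \<open>\<phi> f x = g (f x)\<close>. It is countably affine, because for the
  extension \<open>h\<close> of a sequence \<open>a\<close> the map \<open>\<phi> h = g \<circ> h\<close> is affine, hence
  \<open>g (\<Sum>\<^sub>j p\<^sub>ja\<^sub>j) = \<phi> h (\<Sum>\<^sub>j p\<^sub>j\<delta>\<^sub>j) = \<Sum>\<^sub>j p\<^sub>j (\<phi> h \<delta>\<^sub>j) = \<Sum>\<^sub>j p\<^sub>j (g a\<^sub>j)\<close>.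
  This is the lemma \<open>affine_from_natural_family\<close>. It concerns every full subcategory
  that contains \<open>\<Delta>\<^sub>\<nat>\<close>, of which \<open>\<Omega>\<close> is one.

  A family \<open>\<phi>\<close> as above is a cocone on the canonical diagram of \<open>A\<close>, and equally a natural
  transformation between the presheaves of \<open>A\<close> and \<open>B\<close>. So the lemma gives density, and density of
  any functor makes its restricted Yoneda functor full (existence of \<open>g\<close>) and faithful (uniqueness).

  The two generating spaces are super convex for analytic reasons: the associativity law for
  \<open>\<Delta>\<^sub>\<nat>\<close> is an exchange of two infinite sums with nonnegative terms, and the one for \<open>\<nat>\<close>
  rests on the support of a mixture being the union of the supports of its ingredients.
\<close>

section \<open>Categories, functors and natural transformations\<close>

lemma category_ident: "category C \<Longrightarrow> X \<in> Obj C \<Longrightarrow> Ident C X \<in> Hom C X X"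
  and category_comp: "category C \<Longrightarrow> X \<in> Obj C \<Longrightarrow> Y \<in> Obj C \<Longrightarrow> Z \<in> Obj C \<Longrightarrow>
    f \<in> Hom C X Y \<Longrightarrow> g \<in> Hom C Y Z \<Longrightarrow> Comp C X Y Z g f \<in> Hom C X Z"
  and category_ident_right: "category C \<Longrightarrow> X \<in> Obj C \<Longrightarrow> Y \<in> Obj C \<Longrightarrow> f \<in> Hom C X Y \<Longrightarrow>
    Comp C X X Y f (Ident C X) = f"
  and category_ident_left: "category C \<Longrightarrow> X \<in> Obj C \<Longrightarrow> Y \<in> Obj C \<Longrightarrow> f \<in> Hom C X Y \<Longrightarrow>
    Comp C X Y Y (Ident C Y) f = f"
  and category_assoc: "category C \<Longrightarrow> W \<in> Obj C \<Longrightarrow> X \<in> Obj C \<Longrightarrow> Y \<in> Obj C \<Longrightarrow> Z \<in> Obj C \<Longrightarrow>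
    f \<in> Hom C W X \<Longrightarrow> g \<in> Hom C X Y \<Longrightarrow> h \<in> Hom C Y Z \<Longrightarrow>
    Comp C W X Z (Comp C X Y Z h g) f = Comp C W Y Z h (Comp C W X Y g f)"
  unfolding category_def by blast+

lemma functor_source: "is_functor C D F \<Longrightarrow> category C"
  and functor_target: "is_functor C D F \<Longrightarrow> category D"
  and functor_obj: "is_functor C D F \<Longrightarrow> X \<in> Obj C \<Longrightarrow> omap F X \<in> Obj D"
  and functor_hom: "is_functor C D F \<Longrightarrow> X \<in> Obj C \<Longrightarrow> Y \<in> Obj C \<Longrightarrow> f \<in> Hom C X Y \<Longrightarrow>
    mmap F X Y f \<in> Hom D (omap F X) (omap F Y)"
  and functor_ident: "is_functor C D F \<Longrightarrow> X \<in> Obj C \<Longrightarrow>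
    mmap F X X (Ident C X) = Ident D (omap F X)"
  and functor_comp_map: "is_functor C D F \<Longrightarrow> X \<in> Obj C \<Longrightarrow> Y \<in> Obj C \<Longrightarrow> Z \<in> Obj C \<Longrightarrow>
    f \<in> Hom C X Y \<Longrightarrow> g \<in> Hom C Y Z \<Longrightarrow>
    mmap F X Z (Comp C X Y Z g f) =
      Comp D (omap F X) (omap F Y) (omap F Z) (mmap F Y Z g) (mmap F X Y f)"
  unfolding is_functor_def by blast+

lemma category_op_cat: "category C \<Longrightarrow> category (op_cat C)"
  unfolding category_def[of "op_cat C"]
  by (auto simp: op_cat_def category_ident category_comp category_ident_left category_ident_right
      category_assoc)

lemma category_Set_cat: "category Set_cat"
  unfolding category_def Set_cat_def
  by (auto simp: compose_def fun_eq_iff PiE_iff Pi_iff extensional_def)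

lemma nat_trans_component: "\<eta> \<in> nat_trans C D F G \<Longrightarrow> X \<in> Obj C \<Longrightarrow>
    \<eta> X \<in> Hom D (omap F X) (omap G X)"
  and nat_trans_extensional: "\<eta> \<in> nat_trans C D F G \<Longrightarrow> \<eta> \<in> extensional (Obj C)"
  and nat_trans_square: "\<eta> \<in> nat_trans C D F G \<Longrightarrow> X \<in> Obj C \<Longrightarrow> Y \<in> Obj C \<Longrightarrow> f \<in> Hom C X Y \<Longrightarrow>
    Comp D (omap F X) (omap F Y) (omap G Y) (\<eta> Y) (mmap F X Y f) =
    Comp D (omap F X) (omap G X) (omap G Y) (mmap G X Y f) (\<eta> X)"
  unfolding nat_trans_def by (auto simp: PiE_iff)

lemma ident_nat_trans:
  assumes F: "is_functor C D F"
  shows "(\<lambda>X\<in>Obj C. Ident D (omap F X)) \<in> nat_trans C D F F"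
  unfolding nat_trans_def
  using functor_target[OF F]
  by (auto simp: category_ident category_ident_left category_ident_right functor_obj[OF F]
      functor_hom[OF F])

lemma comp_nat_trans:
  assumes F: "is_functor C D F" and G: "is_functor C D G" and H: "is_functor C D H"
    and \<eta>: "\<eta> \<in> nat_trans C D F G" and \<theta>: "\<theta> \<in> nat_trans C D G H"
  shows "(\<lambda>X\<in>Obj C. Comp D (omap F X) (omap G X) (omap H X) (\<theta> X) (\<eta> X)) \<in> nat_trans C D F H"
proof -
  note D = functor_target[OF F]
  note obj = functor_obj[OF F] functor_obj[OF G] functor_obj[OF H]
  note hom = functor_hom[OF F] functor_hom[OF G] functor_hom[OF H]
  note comp = nat_trans_component[OF \<eta>] nat_trans_component[OF \<theta>]
  have "Comp D (omap F X) (omap F Y) (omap H Y)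
          (Comp D (omap F Y) (omap G Y) (omap H Y) (\<theta> Y) (\<eta> Y)) (mmap F X Y f) =
        Comp D (omap F X) (omap H X) (omap H Y) (mmap H X Y f)
          (Comp D (omap F X) (omap G X) (omap H X) (\<theta> X) (\<eta> X))" (is "?l = ?r")
    if XY: "X \<in> Obj C" "Y \<in> Obj C" and f: "f \<in> Hom C X Y" for X Y f
  proof -
    have "?l = Comp D (omap F X) (omap G Y) (omap H Y) (\<theta> Y)
        (Comp D (omap F X) (omap F Y) (omap G Y) (\<eta> Y) (mmap F X Y f))"
      using XY f by (intro category_assoc[OF D] obj hom comp)
    also have "\<dots> = Comp D (omap F X) (omap G Y) (omap H Y) (\<theta> Y)
        (Comp D (omap F X) (omap G X) (omap G Y) (mmap G X Y f) (\<eta> X))"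
      using nat_trans_square[OF \<eta> XY f] by simp
    also have "\<dots> = Comp D (omap F X) (omap G X) (omap H Y)
        (Comp D (omap G X) (omap G Y) (omap H Y) (\<theta> Y) (mmap G X Y f)) (\<eta> X)"
      using XY f by (intro category_assoc[OF D, symmetric] obj hom comp)
    also have "\<dots> = Comp D (omap F X) (omap G X) (omap H Y)
        (Comp D (omap G X) (omap H X) (omap H Y) (mmap H X Y f) (\<theta> X)) (\<eta> X)"
      using nat_trans_square[OF \<theta> XY f] by simp
    also have "\<dots> = ?r"
      using XY f by (intro category_assoc[OF D] obj hom comp)
    finally show ?thesis .
  qed
  then show ?thesis
    unfolding nat_trans_def by (auto intro: category_comp[OF D] obj comp)
qed

lemma category_functor_cat: "category (functor_cat C D)"
  unfolding category_def functor_cat_def cat.simps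
proof (intro conjI ballI)
  fix F assume "F \<in> {F. is_functor C D F}"
  then show "(\<lambda>X\<in>Obj C. Ident D (omap F X)) \<in> nat_trans C D F F"
    by (simp add: ident_nat_trans)
next
  fix F G H \<eta> \<theta>
  assume "F \<in> {F. is_functor C D F}" "G \<in> {F. is_functor C D F}" "H \<in> {F. is_functor C D F}"
    and "\<eta> \<in> nat_trans C D F G" "\<theta> \<in> nat_trans C D G H"
  then show "(\<lambda>X\<in>Obj C. Comp D (omap F X) (omap G X) (omap H X) (\<theta> X) (\<eta> X)) \<in> nat_trans C D F H"
    by (simp add: comp_nat_trans)
next
  fix F G \<eta>
  assume F: "F \<in> {F. is_functor C D F}" and G: "G \<in> {F. is_functor C D F}"
    and \<eta>: "\<eta> \<in> nat_trans C D F G"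
  have D: "category D" using F by (auto intro: functor_target)
  show "(\<lambda>X\<in>Obj C. Comp D (omap F X) (omap F X) (omap G X) (\<eta> X)
          ((\<lambda>X\<in>Obj C. Ident D (omap F X)) X)) = \<eta>"
    and "(\<lambda>X\<in>Obj C. Comp D (omap F X) (omap G X) (omap G X)
          ((\<lambda>X\<in>Obj C. Ident D (omap G X)) X) (\<eta> X)) = \<eta>"
    using F G nat_trans_component[OF \<eta>]
    by (auto intro!: extensionalityI[OF _ nat_trans_extensional[OF \<eta>]]
        simp: category_ident_left[OF D] category_ident_right[OF D] functor_obj)
next
  fix F G H K \<eta> \<theta> \<zeta>
  assume F: "F \<in> {F. is_functor C D F}" "G \<in> {F. is_functor C D F}" "H \<in> {F. is_functor C D F}"
      "K \<in> {F. is_functor C D F}"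
    and "\<eta> \<in> nat_trans C D F G" "\<theta> \<in> nat_trans C D G H" "\<zeta> \<in> nat_trans C D H K"
  moreover have "category D" using F by (auto intro: functor_target)
  ultimately show
    "(\<lambda>X\<in>Obj C. Comp D (omap F X) (omap G X) (omap K X)
        ((\<lambda>X\<in>Obj C. Comp D (omap G X) (omap H X) (omap K X) (\<zeta> X) (\<theta> X)) X) (\<eta> X)) =
     (\<lambda>X\<in>Obj C. Comp D (omap F X) (omap H X) (omap K X) (\<zeta> X)
        ((\<lambda>X\<in>Obj C. Comp D (omap F X) (omap G X) (omap H X) (\<theta> X) (\<eta> X)) X))"
    by (intro restrict_ext)
      (auto intro!: category_assoc functor_obj elim: nat_trans_component)
qed

lemma category_full_subcategory:
  assumes "category C" "S \<subseteq> Obj C"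
  shows "category (full_subcategory C S)"
  using assms unfolding category_def full_subcategory_def by (simp add: subset_iff)

lemma is_functor_inclusion:
  assumes "category C" "S \<subseteq> Obj C"
  shows "is_functor (full_subcategory C S) C inclusion_functor"
  using assms category_full_subcategory[OF assms]
  by (auto simp: is_functor_def inclusion_functor_def full_subcategory_def)

section \<open>Density and the restricted Yoneda functor\<close>

lemma category_comma_cat:
  assumes K: "is_functor C D K" and d: "d \<in> Obj D"
  shows "category (comma_cat C D K d)"
proof -
  note C = functor_source[OF K] and D = functor_target[OF K]
  \<comment> \<open>Pasting the triangle of \<open>u\<close> over \<open>f'\<close> to that of \<open>v\<close> over \<open>f''\<close>.\<close>
  have comp: "Comp D (omap K c) (omap K c'') d f'' (mmap K c c'' (Comp C c c' c'' v u)) = f"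
    if c: "c \<in> Obj C" "c' \<in> Obj C" "c'' \<in> Obj C" and u: "u \<in> Hom C c c'" and v: "v \<in> Hom C c' c''"
      and f'': "f'' \<in> Hom D (omap K c'') d"
      and uf: "Comp D (omap K c) (omap K c') d f' (mmap K c c' u) = f"
      and vf: "Comp D (omap K c') (omap K c'') d f'' (mmap K c' c'' v) = f'"
    for c c' c'' u v f f' f''
    using category_assoc[OF D functor_obj[OF K c(1)] functor_obj[OF K c(2)]
        functor_obj[OF K c(3)] d functor_hom[OF K c(1,2) u] functor_hom[OF K c(2,3) v] f'']
    by (simp add: functor_comp_map[OF K c u v] uf vf)
  show ?thesis
    unfolding category_def
    by (auto simp: comma_cat_def category_ident[OF C] category_comp[OF C] category_assoc[OF C]
        category_ident_left[OF C] category_ident_right[OF C] functor_ident[OF K]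
        category_ident_right[OF D] functor_obj[OF K] d comp)
qed

lemma is_functor_comma_proj:
  assumes K: "is_functor C D K" and d: "d \<in> Obj D"
  shows "is_functor (comma_cat C D K d) C comma_proj"
  using category_comma_cat[OF assms] functor_source[OF K]
  by (auto simp: is_functor_def comma_cat_def comma_proj_def)

lemma is_functor_functor_comp:
  assumes F: "is_functor C D F" and G: "is_functor D E G"
  shows "is_functor C E (functor_comp G F)"
  unfolding is_functor_def functor_comp_def
  using functor_source[OF F] functor_target[OF G]
  by (auto simp: functor_obj[OF F] functor_obj[OF G] functor_hom[OF F] functor_hom[OF G]
      functor_ident[OF F] functor_ident[OF G] functor_comp_map[OF F] functor_comp_map[OF G])

lemma is_functor_hom_presheaf:
  assumes K: "is_functor C D K" and d: "d \<in> Obj D"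
  shows "is_functor (op_cat C) Set_cat (hom_presheaf C D K d)"
  unfolding is_functor_def
proof (intro conjI)
  show "category (op_cat C)"
    by (rule category_op_cat[OF functor_source[OF K]])
  show "category Set_cat"
    by (rule category_Set_cat)
qed (use functor_target[OF K] d in \<open>auto simp: op_cat_def Set_cat_def
    hom_presheaf_def functor_obj[OF K] functor_hom[OF K] category_comp functor_ident[OF K]
    category_ident_right functor_comp_map[OF K] category_assoc compose_def intro!: restrict_ext\<close>)

lemma is_functor_restricted_yoneda:
  assumes K: "is_functor C D K"
  shows "is_functor D (functor_cat (op_cat C) Set_cat) (restricted_yoneda C D K)"
proof -
  note D = functor_target[OF K]
  note [simp] = category_comp[OF D] category_assoc[OF D] category_ident_left[OF D]
    functor_obj[OF K] functor_hom[OF K]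
  have nt: "(\<lambda>c\<in>Obj C. \<lambda>x\<in>Hom D (omap K c) d. Comp D (omap K c) d d' g x)
      \<in> nat_trans (op_cat C) Set_cat (hom_presheaf C D K d) (hom_presheaf C D K d')"
    if "d \<in> Obj D" "d' \<in> Obj D" "g \<in> Hom D d d'" for d d' g
    using that
    by (auto simp: nat_trans_def op_cat_def Set_cat_def hom_presheaf_def compose_def
        intro!: restrict_ext)
  show ?thesis
    unfolding is_functor_def
    using D category_functor_cat[of "op_cat C" Set_cat] is_functor_hom_presheaf[OF K]
    by (auto simp: restricted_yoneda_def functor_cat_def nt)
      (auto simp: hom_presheaf_def op_cat_def Set_cat_def compose_def intro!: restrict_ext)
qed

text \<open>
  The universal property of the canonical colimit without its comma category: a cocone indexed by
  the pairs \<open>(c, f : K c \<rightarrow> d)\<close> is a natural family of functions \<open>f \<mapsto> \<phi> c f\<close>.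
\<close>

lemma dense_imp_unique_factorization:
  assumes K: "dense_functor C D K" and d: "d \<in> Obj D" and d': "d' \<in> Obj D"
    and hom: "\<And>c f. c \<in> Obj C \<Longrightarrow> f \<in> Hom D (omap K c) d \<Longrightarrow> \<phi> c f \<in> Hom D (omap K c) d'"
    and natural: "\<And>c c' u f. c \<in> Obj C \<Longrightarrow> c' \<in> Obj C \<Longrightarrow> u \<in> Hom C c c' \<Longrightarrow>
      f \<in> Hom D (omap K c') d \<Longrightarrow>
      Comp D (omap K c) (omap K c') d' (\<phi> c' f) (mmap K c c' u) =
        \<phi> c (Comp D (omap K c) (omap K c') d f (mmap K c c' u))"
  shows "\<exists>!g. g \<in> Hom D d d' \<and>
    (\<forall>c\<in>Obj C. \<forall>f\<in>Hom D (omap K c) d. Comp D (omap K c) d d' g f = \<phi> c f)"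
proof -
  let ?J = "comma_cat C D K d" and ?F = "functor_comp K comma_proj"
  have "is_cocone ?J D ?F d' (\<lambda>(c, f). \<phi> c f)"
    unfolding is_cocone_def
    using d' hom natural by (auto simp: comma_cat_def functor_comp_def comma_proj_def)
  moreover have "is_colimit ?J D ?F d (\<lambda>(c, f). f)"
    using K d by (auto simp: dense_functor_def)
  ultimately have "\<exists>!g. g \<in> Hom D d d' \<and>
      (\<forall>j\<in>Obj ?J. Comp D (omap ?F j) d d' g ((\<lambda>(c, f). f) j) = (\<lambda>(c, f). \<phi> c f) j)"
    unfolding is_colimit_def by blast
  then show ?thesis
    by (simp add: comma_cat_def functor_comp_def comma_proj_def)
qed

text \<open>
  A natural transformation between presheaves is a family \<open>\<phi>\<close> of the previous lemma; the
  factorization \<open>g\<close> of that family is its preimage.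
\<close>

lemma dense_imp_full:
  assumes K: "dense_functor C D K"
  shows "full D (functor_cat (op_cat C) Set_cat) (restricted_yoneda C D K)"
  unfolding full_def
proof (intro ballI)
  fix d d' \<eta>
  assume d: "d \<in> Obj D" and d': "d' \<in> Obj D"
    and "\<eta> \<in> Hom (functor_cat (op_cat C) Set_cat) (omap (restricted_yoneda C D K) d)
      (omap (restricted_yoneda C D K) d')"
  then have nt: "\<eta> \<in> nat_trans (op_cat C) Set_cat (hom_presheaf C D K d) (hom_presheaf C D K d')"
    by (simp add: functor_cat_def restricted_yoneda_def)
  then have ext: "\<eta> \<in> extensional (Obj C)"
    and arr: "\<And>c. c \<in> Obj C \<Longrightarrow> \<eta> c \<in> Hom D (omap K c) d \<rightarrow>\<^sub>E Hom D (omap K c) d'"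
    and sq: "\<And>c c' u. c \<in> Obj C \<Longrightarrow> c' \<in> Obj C \<Longrightarrow> u \<in> Hom C c c' \<Longrightarrow>
      compose (Hom D (omap K c') d) (\<eta> c)
        (\<lambda>x\<in>Hom D (omap K c') d. Comp D (omap K c) (omap K c') d x (mmap K c c' u)) =
      compose (Hom D (omap K c') d)
        (\<lambda>x\<in>Hom D (omap K c') d'. Comp D (omap K c) (omap K c') d' x (mmap K c c' u)) (\<eta> c')"
    by (auto simp: nat_trans_def op_cat_def Set_cat_def hom_presheaf_def PiE_iff)
  have nat: "Comp D (omap K c) (omap K c') d' (\<eta> c' f) (mmap K c c' u) =
        \<eta> c (Comp D (omap K c) (omap K c') d f (mmap K c c' u))"
    if "c \<in> Obj C" "c' \<in> Obj C" "u \<in> Hom C c c'" "f \<in> Hom D (omap K c') d" for c c' u f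
    using fun_cong[OF sq[OF that(1-3)], of f] that(4) PiE_mem[OF arr[OF that(2)] that(4)]
    by (simp add: compose_def)
  have hom: "\<eta> c f \<in> Hom D (omap K c) d'" if "c \<in> Obj C" "f \<in> Hom D (omap K c) d" for c f
    using arr that by auto
  obtain g where g: "g \<in> Hom D d d'"
    and fact: "\<And>c f. c \<in> Obj C \<Longrightarrow> f \<in> Hom D (omap K c) d \<Longrightarrow> Comp D (omap K c) d d' g f = \<eta> c f"
    using dense_imp_unique_factorization[OF K d d', of \<eta>] hom nat by blast
  have "mmap (restricted_yoneda C D K) d d' g c = \<eta> c" for c
  proof (cases "c \<in> Obj C")
    case True
    then have "(\<lambda>x\<in>Hom D (omap K c) d. Comp D (omap K c) d d' g x) = \<eta> c"
      using arr[OF True] fact[OF True]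
      by (intro extensionalityI[of _ "Hom D (omap K c) d"]) (auto simp: PiE_iff)
    then show ?thesis using True by (simp add: restricted_yoneda_def)
  next
    case False
    then show ?thesis using ext by (simp add: restricted_yoneda_def extensional_def)
  qed
  then show "\<exists>f\<in>Hom D d d'. mmap (restricted_yoneda C D K) d d' f = \<eta>"
    using g by blast
qed

text \<open>
  Two maps with the same image factor the same family \<open>f \<mapsto> h \<circ> f\<close>, and that factorization is unique.
\<close>

lemma dense_imp_faithful:
  assumes K: "dense_functor C D K"
  shows "faithful D (restricted_yoneda C D K)"
  unfolding faithful_def
proof (intro ballI inj_onI)
  fix d d' g h
  assume d: "d \<in> Obj D" and d': "d' \<in> Obj D" and g: "g \<in> Hom D d d'" and h: "h \<in> Hom D d d'"
    and eq: "mmap (restricted_yoneda C D K) d d' g = mmap (restricted_yoneda C D K) d d' h"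
  have K_functor: "is_functor C D K"
    using K by (simp add: dense_functor_def)
  note D = functor_target[OF K_functor]
  have "Comp D (omap K c) d d' g f = Comp D (omap K c) d d' h f"
    if "c \<in> Obj C" "f \<in> Hom D (omap K c) d" for c f
    using fun_cong[OF fun_cong[OF eq, of c], of f] that by (simp add: restricted_yoneda_def)
  moreover have "\<exists>!k. k \<in> Hom D d d' \<and> (\<forall>c\<in>Obj C. \<forall>f\<in>Hom D (omap K c) d.
      Comp D (omap K c) d d' k f = Comp D (omap K c) d d' h f)"
    by (rule dense_imp_unique_factorization[OF K d d'])
      (simp_all add: category_comp[OF D] category_assoc[OF D] functor_obj[OF K_functor]
        functor_hom[OF K_functor] d d' h)
  ultimately show "g = h"
    using g h by blast
qed

section \<open>Countable mixtures of probability sequences\<close>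

lemma dirac_in_GN: "dirac j \<in> GN"
  using sums_single[of j "\<lambda>_. 1 :: real"] by (auto simp: GN_def dirac_def)

lemma GN_I:
  assumes "\<And>i. 0 \<le> p i" "p sums 1"
  shows "p \<in> GN"
proof -
  have "p i \<le> 1" for i
    using sum_le_suminf[of p "{i}"] assms by (simp add: sums_iff)
  then show ?thesis using assms by (simp add: GN_def)
qed

text \<open>
  Tonelli's theorem for double series. Unconditional sums over \<open>\<nat> \<times> \<nat>\<close> are symmetric in the two
  indices, and for nonnegative terms they agree with iterated series.
\<close>

lemma sums_swap_nonneg:
  fixes f :: "nat \<Rightarrow> nat \<Rightarrow> real"
  assumes nonneg: "\<And>j i. 0 \<le> f j i" and rows: "\<And>j. f j sums r j" and total: "r sums s"
  shows "summable (\<lambda>j. f j i)" and "(\<lambda>i. \<Sum>j. f j i) sums s"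
proof -
  have r0: "0 \<le> r j" for j
    using rows[of j] nonneg suminf_nonneg[of "f j"] by (simp add: sums_iff)
  have rows': "((\<lambda>i. case (j, i) of (j, i) \<Rightarrow> f j i) has_sum r j) UNIV" for j
    using sums_nonneg_imp_has_sum[OF rows] nonneg by simp
  have total': "(r has_sum s) UNIV"
    using sums_nonneg_imp_has_sum[OF total] r0 by simp
  have "((\<lambda>(j, i). f j i) has_sum s) (UNIV \<times> UNIV)"
  proof (rule has_sum_SigmaI[where f = "\<lambda>(j, i). f j i" and g = r])
    show "(\<lambda>(j, i). f j i) summable_on UNIV \<times> UNIV"
      by (rule summable_on_SigmaI[where f = "\<lambda>(j, i). f j i" and g = r])
        (use rows' total' nonneg in \<open>auto intro: has_sum_imp_summable\<close>)
  qed (use rows' total' in auto)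
  then have swapped: "((\<lambda>(i, j). f j i) has_sum s) (UNIV \<times> UNIV)"
    by (subst (asm) has_sum_swap) simp
  then have column: "(\<lambda>j. f j i) summable_on UNIV" for i
    using summable_on_SigmaD1[of "\<lambda>i j. f j i" UNIV "\<lambda>_. UNIV" i]
    by (auto simp: has_sum_imp_summable)
  then show summable: "summable (\<lambda>j. f j i)" for i
    by (rule summable_on_imp_summable)
  have "((\<lambda>j. f j i) has_sum (\<Sum>j. f j i)) UNIV" for i
    using summable[of i] nonneg by (intro sums_nonneg_imp_has_sum) auto
  then have "((\<lambda>i. \<Sum>j. f j i) has_sum s) UNIV"
    using swapped by (intro has_sum_SigmaD[OF swapped]) auto
  then show "(\<lambda>i. \<Sum>j. f j i) sums s"
    by (rule has_sum_imp_sums)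
qed

lemma
  assumes p: "p \<in> GN" and Q: "\<And>j. Q j \<in> GN"
  shows summable_mix: "summable (\<lambda>j. p j * Q j i)" and mix_in_GN: "mix p Q \<in> GN"
proof -
  have nonneg: "0 \<le> p j * Q j i" for j i
    using p Q[of j] by (simp add: GN_def)
  have rows: "(\<lambda>i. p j * Q j i) sums p j" for j
    using sums_mult[of "Q j" 1 "p j"] Q[of j] by (simp add: GN_def)
  have total: "p sums 1"
    using p by (simp add: GN_def)
  note swap = sums_swap_nonneg[of "\<lambda>j i. p j * Q j i", OF nonneg rows total]
  show summable: "summable (\<lambda>j. p j * Q j i)" for i
    by (rule swap)
  show "mix p Q \<in> GN"
    unfolding mix_def using swap by (intro GN_I suminf_nonneg nonneg)
qed

text \<open>This makes the minimum over a mixed support the minimum of the minima.\<close>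

lemma mix_pos_iff:
  assumes p: "p \<in> GN" and Q: "\<And>j. Q j \<in> GN"
  shows "0 < mix p Q i \<longleftrightarrow> (\<exists>j. 0 < p j \<and> 0 < Q j i)"
proof -
  have "0 \<le> p j" "0 \<le> Q j i" for j
    using p Q[of j] by (simp_all add: GN_def)
  then show ?thesis
    unfolding mix_def
    using suminf_pos_iff[OF summable_mix[where Q = Q, OF p Q], of i]
    by (auto simp: zero_less_mult_iff) (meson not_less)+
qed

text \<open>
  Both sides sum \<open>p\<^sub>j Q\<^sub>j\<^sub>i a\<^sub>i\<^sub>k\<close> over \<open>i\<close> and \<open>j\<close>, in opposite orders.
\<close>

lemma mix_mix:
  assumes p: "p \<in> GN" and Q: "\<And>j. Q j \<in> GN" and a: "\<And>i. a i \<in> GN"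
  shows "mix p (\<lambda>j. mix (Q j) a) = mix (mix p Q) a"
proof
  fix k
  have nonneg: "0 \<le> p j" "0 \<le> Q j i" "0 \<le> a i k" for i j
    using p Q[of j] a[of i] by (simp_all add: GN_def)
  have rows: "(\<lambda>i. p j * Q j i * a i k) sums (p j * mix (Q j) a k)" for j
    using sums_mult[OF summable_sums[OF summable_mix[where Q = a, OF Q a]], of "p j" j k]
    by (simp add: mix_def mult.assoc)
  have total: "(\<lambda>j. p j * mix (Q j) a k) sums mix p (\<lambda>j. mix (Q j) a) k"
    using summable_mix[OF p mix_in_GN[OF Q a]]
    by (simp add: mix_def[of p] summable_sums)
  have "(\<lambda>i. \<Sum>j. p j * Q j i * a i k) sums mix p (\<lambda>j. mix (Q j) a) k"
    by (rule sums_swap_nonneg[OF _ rows total]) (simp add: nonneg)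
  moreover have "(\<Sum>j. p j * Q j i * a i k) = mix p Q i * a i k" for i
    unfolding mix_def
    by (rule suminf_mult2[symmetric, OF summable_mix[OF p Q]])
  ultimately show "mix p (\<lambda>j. mix (Q j) a) k = mix (mix p Q) a k"
    by (simp add: mix_def[of "mix p Q"] sums_iff)
qed

lemma mix_dirac_left: "mix (dirac j) Q = Q j"
proof
  fix i
  show "mix (dirac j) Q i = Q j i"
    using sums_single[of j "\<lambda>l. Q l i"]
    by (simp add: mix_def dirac_def sums_iff if_distrib[of "\<lambda>x. x * _"] cong: if_cong)
qed

lemma mix_dirac_right: "mix p dirac = p"
proof
  fix i
  show "mix p dirac i = p i"
    using sums_single[of i p]
    by (simp add: mix_def dirac_def sums_iff if_distrib[of "\<lambda>x. _ * x"] eq_commute cong: if_cong)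
qed

lemma GN_pos:
  assumes "p \<in> GN"
  shows "\<exists>i. 0 < p i"
proof (rule ccontr)
  assume "\<nexists>i. 0 < p i"
  then have "p = (\<lambda>_. 0)"
    using assms by (auto simp: GN_def fun_eq_iff not_less order_antisym)
  then show False
    using assms sums_unique2[OF sums_zero, of "1 :: real"] by (auto simp: GN_def)
qed

section \<open>Super convex spaces\<close>

lemma csum_closed: "super_convex_space A \<Longrightarrow> p \<in> GN \<Longrightarrow> (\<And>i. a i \<in> carrier A) \<Longrightarrow>
    csum A p a \<in> carrier A"
  and csum_dirac: "super_convex_space A \<Longrightarrow> (\<And>i. a i \<in> carrier A) \<Longrightarrow> csum A (dirac j) a = a j"
  and csum_csum: "super_convex_space A \<Longrightarrow> p \<in> GN \<Longrightarrow> (\<And>j. Q j \<in> GN) \<Longrightarrow>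
    (\<And>i. a i \<in> carrier A) \<Longrightarrow> csum A p (\<lambda>j. csum A (Q j) a) = csum A (mix p Q) a"
  unfolding super_convex_space_def by (auto simp: Pi_iff)

lemma affine_ext: "m \<in> countably_affine A B \<Longrightarrow> m \<in> carrier A \<rightarrow>\<^sub>E carrier B"
  and affine_closed: "m \<in> countably_affine A B \<Longrightarrow> x \<in> carrier A \<Longrightarrow> m x \<in> carrier B"
  and affine_csum: "m \<in> countably_affine A B \<Longrightarrow> p \<in> GN \<Longrightarrow> (\<And>i. a i \<in> carrier A) \<Longrightarrow>
    m (csum A p a) = csum B p (\<lambda>i. m (a i))"
  unfolding countably_affine_def by (auto simp: Pi_iff)

lemma category_SCvx: "category SCvx"
  unfolding category_def SCvx_def countably_affine_def
  by (auto simp: compose_def fun_eq_iff PiE_iff Pi_iff extensional_def csum_closed)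

lemma super_convex_simplex_space: "super_convex_space simplex_space"
  unfolding super_convex_space_def simplex_space_def
  by (simp add: Pi_iff mix_in_GN mix_mix mix_dirac_left)

text \<open>
  The least elements below exist because each support is nonempty; the associativity law compares
  the minimum over \<open>j\<close> of the minima over the supports of the \<open>Q\<^sub>j\<close> with the minimum over their union.
\<close>

lemma super_convex_nat_space: "super_convex_space nat_space"
proof -
  have dirac: "(LEAST n. \<exists>i. 0 < dirac j i \<and> n = a i) = a j" for j and a :: "nat \<Rightarrow> nat"
    by (rule Least_equality) (auto simp: dirac_def split: if_splits)
  have nested: "(LEAST n. \<exists>j. 0 < p j \<and> n = (LEAST m. \<exists>i. 0 < Q j i \<and> m = a i)) =
      (LEAST n. \<exists>i. 0 < mix p Q i \<and> n = a i)" (is "?l = (LEAST n. ?R n)")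
    if p: "p \<in> GN" and Q: "\<And>j. Q j \<in> GN" for p Q and a :: "nat \<Rightarrow> nat"
  proof -
    let ?m = "\<lambda>j. LEAST m. \<exists>i. 0 < Q j i \<and> m = a i"
    have attained: "\<exists>i. 0 < Q j i \<and> ?m j = a i" for j
      using LeastI_ex[of "\<lambda>m. \<exists>i. 0 < Q j i \<and> m = a i"] GN_pos[OF Q] by blast
    have bound: "?m j \<le> a i" if "0 < Q j i" for i j
      using that by (intro Least_le) blast
    have R_attained: "?R (LEAST n. ?R n)"
      using LeastI_ex[of ?R] GN_pos[OF mix_in_GN[where Q = Q, OF p Q]] by blast
    then obtain j i where j: "0 < p j" and i: "0 < Q j i" "(LEAST n. ?R n) = a i"
      using mix_pos_iff[where Q = Q, OF p Q] by blast
    have R_bound: "(LEAST n. ?R n) \<le> ?m j'" if "0 < p j'" for j'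
    proof -
      obtain i' where "0 < Q j' i'" "?m j' = a i'"
        using attained by blast
      moreover from this have "0 < mix p Q i'"
        using that mix_pos_iff[where Q = Q, OF p Q] by blast
      ultimately show ?thesis
        by (intro Least_le) metis
    qed
    have "?m j = (LEAST n. ?R n)"
      using bound[OF i(1)] R_bound[OF j] i(2) by simp
    then show ?thesis
      using j R_bound by (intro Least_equality) auto
  qed
  show ?thesis
    unfolding super_convex_space_def nat_space_def
    by (simp add: Pi_iff dirac nested)
qed

lemma super_convex_transport:
  assumes A: "super_convex_space A" and e: "inj_on e (carrier A)"
  shows "super_convex_space (transport e A)"
proof -
  have inv: "inv_into (carrier A) e (a i) \<in> carrier A" if "a \<in> UNIV \<rightarrow> e ` carrier A"
    for a :: "nat \<Rightarrow> 'b" and i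
    using that by (intro inv_into_into) auto
  show ?thesis
    unfolding super_convex_space_def transport_def sc_space.simps
    using e by (auto simp: inv csum_closed[OF A] csum_dirac[OF A] csum_csum[OF A] Pi_iff f_inv_into_f
      inv_into_f_f inv_into_into)
qed

lemma super_convex_N_obj: "super_convex_space N_obj"
  unfolding N_obj_def
  by (intro super_convex_transport super_convex_nat_space) (simp add: inj_on_def)

lemma super_convex_Delta_obj: "super_convex_space Delta_obj"
  unfolding Delta_obj_def
  by (intro super_convex_transport super_convex_simplex_space) (simp add: inj_on_def)

lemma carrier_Delta_obj: "carrier Delta_obj = Seq_Point ` GN"
  by (simp add: Delta_obj_def transport_def simplex_space_def)

lemma csum_Delta_obj:
  assumes "\<And>i. Q i \<in> GN"
  shows "csum Delta_obj p (\<lambda>i. Seq_Point (Q i)) = Seq_Point (mix p Q)"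
  using assms
  by (simp add: Delta_obj_def transport_def simplex_space_def inj_on_def inv_into_f_f)

text \<open>
  The constant sequence \<open>x\<close> is \<open>j \<mapsto> \<Sum>\<^sub>i (\<delta>\<^sub>0)\<^sub>i x\<close>, so associativity replaces \<open>p\<close> by the mixture
  of copies of \<open>\<delta>\<^sub>0\<close> with weights \<open>p\<close>, which is \<open>\<delta>\<^sub>0\<close>.
\<close>

lemma csum_const:
  assumes A: "super_convex_space A" and p: "p \<in> GN" and x: "x \<in> carrier A"
  shows "csum A p (\<lambda>_. x) = x"
proof -
  have const: "csum A q (\<lambda>_. x) = csum A (mix q (\<lambda>_. dirac 0)) (\<lambda>_. x)" if "q \<in> GN" for q
    using csum_csum[OF A that, of "\<lambda>_. dirac 0" "\<lambda>_. x"] x csum_dirac[OF A, of "\<lambda>_. x" 0]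
    by (simp add: dirac_in_GN)
  have "mix p (\<lambda>_. dirac 0) = dirac 0"
    using p suminf_mult2[of p "dirac 0 _"] by (auto simp: mix_def GN_def sums_iff fun_eq_iff)
  then show ?thesis
    using const[OF p] csum_dirac[OF A, of "\<lambda>_. x" 0] x by simp
qed

section \<open>Density of the simplex\<close>

lemma const_affine:
  assumes "super_convex_space A" "super_convex_space B" "x \<in> carrier B"
  shows "(\<lambda>_\<in>carrier A. x) \<in> countably_affine A B"
  using assms by (auto simp: countably_affine_def csum_const csum_closed Pi_iff)

text \<open>
  The extension of a sequence along the generators \<open>\<delta>\<^sub>j\<close> of the simplex.
\<close>

definition free_extension :: "'a point sc_space \<Rightarrow> (nat \<Rightarrow> 'a point) \<Rightarrow> 'a point \<Rightarrow> 'a point" where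
  "free_extension A a = (\<lambda>x\<in>carrier Delta_obj. case x of Seq_Point p \<Rightarrow> csum A p a)"

text \<open>For elements \<open>Q\<^sub>j\<close> of the simplex, affinity is the associativity law of \<open>A\<close>.\<close>

lemma free_extension_affine:
  assumes A: "super_convex_space A" and a: "\<And>i. a i \<in> carrier A"
  shows "free_extension A a \<in> countably_affine Delta_obj A"
proof -
  have "free_extension A a (csum Delta_obj p x) = csum A p (\<lambda>i. free_extension A a (x i))"
    if p: "p \<in> GN" and x: "x \<in> UNIV \<rightarrow> carrier Delta_obj" for p and x :: "nat \<Rightarrow> 'a point"
  proof -
    have "\<forall>i. \<exists>q. q \<in> GN \<and> x i = Seq_Point q"
      using x by (auto simp: carrier_Delta_obj Pi_iff image_iff)
    then obtain Q where Q: "\<And>i. Q i \<in> GN" and x_eq: "x = (\<lambda>i. Seq_Point (Q i))"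
      by metis
    show ?thesis
      by (simp add: x_eq csum_Delta_obj Q free_extension_def carrier_Delta_obj
          mix_in_GN[OF p Q] csum_csum[OF A p Q a])
  qed
  then show ?thesis
    using csum_closed[OF A _ a]
    by (auto simp: countably_affine_def free_extension_def carrier_Delta_obj)
qed

lemma free_extension_eq:
  "p \<in> GN \<Longrightarrow> free_extension A a (Seq_Point p) = csum A p a"
  by (simp add: free_extension_def carrier_Delta_obj)

text \<open>
  The heart of the matter. Constant maps out of the simplex determine \<open>g\<close> and link \<open>\<phi>\<close> at any \<open>c\<close>
  to \<open>\<phi>\<close> at the simplex, and freeness of the simplex makes \<open>g\<close> affine.
\<close>

lemma affine_from_natural_family:
  fixes S :: "'a point sc_space set"
    and \<phi> :: "'a point sc_space \<Rightarrow> ('a point \<Rightarrow> 'a point) \<Rightarrow> 'a point \<Rightarrow> 'a point"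
  assumes S: "S \<subseteq> Obj SCvx" and Delta: "Delta_obj \<in> S"
    and A: "super_convex_space A" and B: "super_convex_space B"
    and hom: "\<And>c f. c \<in> S \<Longrightarrow> f \<in> countably_affine c A \<Longrightarrow> \<phi> c f \<in> countably_affine c B"
    and natural: "\<And>c c' u f. c \<in> S \<Longrightarrow> c' \<in> S \<Longrightarrow> u \<in> countably_affine c c' \<Longrightarrow>
      f \<in> countably_affine c' A \<Longrightarrow>
      compose (carrier c) (\<phi> c' f) u = \<phi> c (compose (carrier c) f u)"
  shows "\<exists>!g. g \<in> countably_affine A B \<and>
    (\<forall>c\<in>S. \<forall>f\<in>countably_affine c A. compose (carrier c) g f = \<phi> c f)"
proof -
  let ?D = "Delta_obj :: 'a point sc_space" and ?e = "\<lambda>j. Seq_Point (dirac j) :: 'a point"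
  have e: "?e j \<in> carrier ?D" for j
    by (simp add: carrier_Delta_obj dirac_in_GN)
  have space: "super_convex_space c" if "c \<in> S" for c
    using S that by (auto simp: SCvx_def)
  note D = space[OF Delta]
  define pt where "pt x = (\<lambda>_\<in>carrier ?D. x)" for x :: "'a point"
  have pt: "pt x \<in> countably_affine ?D c" if "super_convex_space c" "x \<in> carrier c" for c x
    unfolding pt_def using const_affine[OF D that] .
  \<comment> \<open>Evaluation at any other point of the simplex would do as well as at \<open>\<delta>\<^sub>0\<close>.\<close>
  define g where "g = (\<lambda>x\<in>carrier A. \<phi> ?D (pt x) (?e 0))"
  have point: "\<phi> c f x = g (f x)"
    if c: "c \<in> S" and f: "f \<in> countably_affine c A" and x: "x \<in> carrier c" for c f x
  proof -
    have "compose (carrier ?D) f (pt x) = pt (f x)"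
      by (auto simp: pt_def compose_def)
    then have "compose (carrier ?D) (\<phi> c f) (pt x) = \<phi> ?D (pt (f x))"
      using natural[OF Delta c pt[OF space[OF c] x] f] by simp
    from fun_cong[OF this, of "?e 0"] show ?thesis
      using e affine_closed[OF f x] by (simp add: compose_def pt_def g_def)
  qed
  have g_closed: "g x \<in> carrier B" if "x \<in> carrier A" for x
    using affine_closed[OF hom[OF Delta pt[OF A that]] e] that by (simp add: g_def)
  have "g (csum A p a) = csum B p (\<lambda>i. g (a i))"
    if p: "p \<in> GN" and "a \<in> UNIV \<rightarrow> carrier A" for p a
  proof -
    have a: "a i \<in> carrier A" for i using that by auto
    let ?h = "free_extension A a"
    note h = free_extension_affine[OF A a]
    have Seq_p: "Seq_Point p = csum ?D p ?e"
      by (simp add: csum_Delta_obj dirac_in_GN mix_dirac_right)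
    have "g (csum A p a) = g (?h (Seq_Point p))"
      by (simp add: free_extension_eq p)
    also have "\<dots> = \<phi> ?D ?h (Seq_Point p)"
      using point[OF Delta h] p by (simp add: carrier_Delta_obj)
    also have "\<dots> = csum B p (\<lambda>i. \<phi> ?D ?h (?e i))"
      unfolding Seq_p by (rule affine_csum[OF hom[OF Delta h] p e])
    also have "\<dots> = csum B p (\<lambda>i. g (a i))"
      using point[OF Delta h e] by (simp add: free_extension_eq dirac_in_GN csum_dirac[OF A a])
    finally show ?thesis .
  qed
  then have g: "g \<in> countably_affine A B"
    using g_closed by (auto simp: countably_affine_def g_def)
  have factor: "compose (carrier c) g f = \<phi> c f" if "c \<in> S" "f \<in> countably_affine c A" for c f
    using point[OF that] affine_ext[OF hom[OF that]]
    by (intro extensionalityI[of _ "carrier c"]) (auto simp: compose_def PiE_iff)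
  show ?thesis
  proof (rule ex1I[of _ g])
    show "g \<in> countably_affine A B \<and>
      (\<forall>c\<in>S. \<forall>f\<in>countably_affine c A. compose (carrier c) g f = \<phi> c f)"
      using g factor by blast
  next
    fix k
    assume k: "k \<in> countably_affine A B \<and>
      (\<forall>c\<in>S. \<forall>f\<in>countably_affine c A. compose (carrier c) k f = \<phi> c f)"
    have "k x = g x" if x: "x \<in> carrier A" for x
    proof -
      have "compose (carrier ?D) k (pt x) = compose (carrier ?D) g (pt x)"
        using k factor Delta pt[OF A x] by simp
      from fun_cong[OF this, of "?e 0"] show ?thesis
        using e by (simp add: compose_def pt_def)
    qed
    then show "k = g"
      using k g
      by (intro extensionalityI[of _ "carrier A"]) (auto simp: PiE_iff dest!: affine_ext)
  qed
qed

lemma dense_full_subcategory_SCvx: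
  fixes S :: "'a point sc_space set"
  assumes S: "S \<subseteq> Obj SCvx" and Delta: "Delta_obj \<in> S"
  shows "dense_functor (full_subcategory SCvx S) SCvx inclusion_functor"
proof -
  let ?C = "full_subcategory SCvx S" and ?K = "inclusion_functor ::
    ('a point sc_space, 'a point \<Rightarrow> 'a point, 'a point sc_space, 'a point \<Rightarrow> 'a point) functr"
  have K: "is_functor ?C SCvx ?K"
    using S by (rule is_functor_inclusion[OF category_SCvx])
  have "is_colimit (comma_cat ?C SCvx ?K A) SCvx (functor_comp ?K comma_proj) A (\<lambda>(c, f). f)"
    if A: "A \<in> Obj SCvx" for A
    unfolding is_colimit_def
  proof (intro conjI allI impI)
    show "is_functor (comma_cat ?C SCvx ?K A) SCvx (functor_comp ?K comma_proj)"
      by (rule is_functor_functor_comp[OF is_functor_comma_proj[OF K A] K])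
    show "is_cocone (comma_cat ?C SCvx ?K A) SCvx (functor_comp ?K comma_proj) A (\<lambda>(c, f). f)"
      using A by (auto simp: is_cocone_def comma_cat_def functor_comp_def comma_proj_def)
  next
    fix B \<nu>
    assume \<nu>: "is_cocone (comma_cat ?C SCvx ?K A) SCvx (functor_comp ?K comma_proj) B \<nu>"
    have B: "super_convex_space B"
      using \<nu> by (auto simp: is_cocone_def SCvx_def)
    have hom: "\<nu> (c, f) \<in> countably_affine c B" if "c \<in> S" "f \<in> countably_affine c A" for c f
      using \<nu> that
      by (auto simp: is_cocone_def comma_cat_def functor_comp_def comma_proj_def
          inclusion_functor_def full_subcategory_def SCvx_def)
    have natural: "compose (carrier c) (\<nu> (c', f)) u = \<nu> (c, compose (carrier c) f u)"
      if c: "c \<in> S" "c' \<in> S" and u: "u \<in> countably_affine c c'" and f: "f \<in> countably_affine c' A"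
      for c c' u f
    proof -
      have "compose (carrier c) f u \<in> countably_affine c A"
        using category_comp[OF category_SCvx, of c c' A u f] S c u f A
        by (auto simp: SCvx_def subset_iff)
      then show ?thesis
        using \<nu> c u f
        by (auto simp: is_cocone_def comma_cat_def functor_comp_def comma_proj_def
            inclusion_functor_def full_subcategory_def SCvx_def)
    qed
    have "\<exists>!g. g \<in> countably_affine A B \<and>
        (\<forall>c\<in>S. \<forall>f\<in>countably_affine c A. compose (carrier c) g f = \<nu> (c, f))"
      using S Delta _ B hom natural
      by (rule affine_from_natural_family) (use A in \<open>simp add: SCvx_def\<close>)
    then show "\<exists>!g. g \<in> Hom SCvx A B \<and>
        (\<forall>j\<in>Obj (comma_cat ?C SCvx ?K A).
          Comp SCvx (omap (functor_comp ?K comma_proj) j) A B g ((\<lambda>(c, f). f) j) = \<nu> j)"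
      by (simp add: comma_cat_def functor_comp_def comma_proj_def
          inclusion_functor_def full_subcategory_def SCvx_def)
  qed
  then show ?thesis
    using K by (simp add: dense_functor_def)
qed

theorem corollary4p3:
  shows "dense_functor (Omega :: 'a point sc_cat) SCvx iota \<and>
         is_functor (SCvx :: 'a point sc_cat) (functor_cat (op_cat Omega) Set_cat)
           (restricted_yoneda Omega SCvx iota) \<and>
         full (SCvx :: 'a point sc_cat) (functor_cat (op_cat Omega) Set_cat)
           (restricted_yoneda Omega SCvx iota) \<and>
         faithful (SCvx :: 'a point sc_cat) (restricted_yoneda Omega SCvx iota)"
proof -
  have "{N_obj, Delta_obj} \<subseteq> Obj (SCvx :: 'a point sc_cat)"
    by (simp add: SCvx_def super_convex_N_obj super_convex_Delta_obj)
  then have dense: "dense_functor (Omega :: 'a point sc_cat) SCvx iota"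
    unfolding Omega_def iota_def by (rule dense_full_subcategory_SCvx) simp
  then have "is_functor (Omega :: 'a point sc_cat) SCvx iota"
    by (simp add: dense_functor_def)
  then show ?thesis
    using dense is_functor_restricted_yoneda dense_imp_full dense_imp_faithful by blast
qed

end
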